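(* Let $\mu>0$ be a constant and let $n\geq2$ be an integer. For each constant $a>0$ define, for $t,r>0$, $$u_{\mathrm{ss}}(t,r)=(4\mu)^{\frac n2}\,t^{\frac n2-1}\,r^{1-n}\,\frac{e^{-\frac{r^2}{4\mu t}}}{a+\int_{\frac{r^2}{4\mu t}}^\infty s^{-\frac n2}e^{-s}\,ds},$$ and set $\mathbf{u}_{\mathrm{ss}}(t,\mathbf{x})=u_{\mathrm{ss}}(t,|\mathbf{x}|)\frac{\mathbf{x}}{|\mathbf{x}|}$ for $t>0$, $\mathbf{x}\neq\mathbf{0}$, and $\mathbf{u}_{\mathrm{ss}}(t,\mathbf{0})=\mathbf{0}$ for $t>0$. Then $\mathbf{u}_{\mathrm{ss}}$ is a self-similar solution of $\mathbf{u}_t+(\mathbf{u}\cdot\nabla)\mathbf{u}=\mu\Delta\mathbf{u}$, satisfied classically on $(0,\infty)\times(\mathbb{R}^n\smallsetminus\{\mathbf{0}\})$; it is non-vanishing for $\mathbf{x}\neq\mathbf{0}$; for each fixed $t>0$ it is unbounded near $\mathbf{x}=\mathbf{0}$; and, for every $p$ with $1\leq p<n$, $$\|\mathbf{u}_{\mathrm{ss}}(t)\|_{L^p(\mathbb{R}^n)}\to0\qquad\text{as } t\to0+.$$ In particular, there are infinitely many such self-similar solutions attaining vanishing initial data in the sense of $L^p(\mathbb{R}^n)$ whenever $1\leq p<n$.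
   Context: For $\mathbf{u}=(u_1,\dots,u_n)^T$ depending on $(t,\mathbf{x})$ with $t>0$, $\mathbf{x}\in\mathbb{R}^n$, one sets $(\mathbf{u}\cdot\nabla)\mathbf{u}:=(D_{\mathbf{x}}\mathbf{u})\,\mathbf{u}$, where $D_{\mathbf{x}}\mathbf{u}$ is the Jacobian matrix of $\mathbf{u}$ with respect to $\mathbf{x}$; $\Delta$ is the Laplacian in $\mathbf{x}$, acting component-wise. Self-similar means that $u_{\mathrm{ss}}(t,r)=\lambda u_{\mathrm{ss}}(\lambda^2t,\lambda r)$ for all $\lambda>0$ and all $t,r>0$. *)

theory Defs
  imports "HOL-Analysis.Analysis"
begin

text \<open>A time-dependent field is a curried function of \<open>t\<close> and \<open>x\<close>. All the derivatives below are
  total functions with arbitrary values where the derivative does not exist; existence is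
  required separately in \<open>C12_on\<close>.\<close>

definition partial_deriv :: "'n::finite \<Rightarrow> (real ^ 'n \<Rightarrow> 'b::real_normed_vector) \<Rightarrow> real ^ 'n \<Rightarrow> 'b"
  where "partial_deriv i f x = frechet_derivative f (at x) (axis i 1)"

definition time_deriv :: "(real \<Rightarrow> real ^ 'n \<Rightarrow> 'b::real_normed_vector) \<Rightarrow> real \<Rightarrow> real ^ 'n::finite \<Rightarrow> 'b"
  where "time_deriv u t x = vector_derivative (\<lambda>s. u s x) (at t)"

definition laplacian :: "(real ^ 'n::finite \<Rightarrow> real) \<Rightarrow> real ^ 'n \<Rightarrow> real"
  where "laplacian f x = (\<Sum>i\<in>UNIV. partial_deriv i (partial_deriv i f) x)"

definition vec_laplacian :: "(real ^ 'n::finite \<Rightarrow> real ^ 'm::finite) \<Rightarrow> real ^ 'n \<Rightarrow> real ^ 'm"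
  where "vec_laplacian f x = (\<chi> j. laplacian (\<lambda>y. f y $ j) x)"

definition convective :: "(real ^ 'n::finite \<Rightarrow> real ^ 'n) \<Rightarrow> real ^ 'n \<Rightarrow> real ^ 'n"
  where "convective f x = jacobian f (at x) *v f x"

text \<open>Regularity of class \<open>C\<^sup>1\<close> in \<open>t\<close> and \<open>C\<^sup>2\<close> in \<open>x\<close>, with all the derivatives
  jointly continuous. It is meant for open \<open>Q\<close>.\<close>

definition C12_on :: "(real \<times> (real ^ 'n::finite)) set \<Rightarrow> (real \<Rightarrow> real ^ 'n \<Rightarrow> 'b::real_normed_vector) \<Rightarrow> bool"
  where "C12_on Q u \<longleftrightarrow>
    (\<forall>(t, x)\<in>Q. (\<lambda>s. u s x) differentiable (at t) \<and> u t differentiable (at x) \<and>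
       (\<forall>i. partial_deriv i (u t) differentiable (at x))) \<and>
    continuous_on Q (\<lambda>(t, x). u t x) \<and>
    continuous_on Q (\<lambda>(t, x). time_deriv u t x) \<and>
    (\<forall>i. continuous_on Q (\<lambda>(t, x). partial_deriv i (u t) x)) \<and>
    (\<forall>i j. continuous_on Q (\<lambda>(t, x). partial_deriv i (partial_deriv j (u t)) x))"

definition classical_solution_on ::
    "real \<Rightarrow> (real \<times> (real ^ 'n::finite)) set \<Rightarrow> (real \<Rightarrow> real ^ 'n \<Rightarrow> real ^ 'n) \<Rightarrow> bool"
  where "classical_solution_on \<mu> Q u \<longleftrightarrow> C12_on Q u \<and>
    (\<forall>(t, x)\<in>Q. time_deriv u t x + convective (u t) x = \<mu> *\<^sub>R vec_laplacian (u t) x)"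

definition self_similar :: "(real \<Rightarrow> real \<Rightarrow> real) \<Rightarrow> bool"
  where "self_similar w \<longleftrightarrow> (\<forall>l>0. \<forall>t>0. \<forall>r>0. w t r = l * w (l\<^sup>2 * t) (l * r))"

definition radial_field :: "(real \<Rightarrow> real \<Rightarrow> real) \<Rightarrow> real \<Rightarrow> real ^ 'n::finite \<Rightarrow> real ^ 'n"
  where "radial_field w t x = (if x = 0 then 0 else w t (norm x) *\<^sub>R (x /\<^sub>R norm x))"

definition u_ss :: "nat \<Rightarrow> real \<Rightarrow> real \<Rightarrow> real \<Rightarrow> real \<Rightarrow> real"
  where "u_ss n \<mu> a t r =
    (4 * \<mu>) powr (real n / 2) * t powr (real n / 2 - 1) * r powr (1 - real n) *
    (exp (- (r\<^sup>2 / (4 * \<mu> * t))) /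
     (a + (LINT s:{r\<^sup>2 / (4 * \<mu> * t)..}|lborel. s powr (- (real n / 2)) * exp (- s))))"

definition u_ss_field :: "real \<Rightarrow> real \<Rightarrow> real \<Rightarrow> real ^ 'n::finite \<Rightarrow> real ^ 'n"
  where "u_ss_field \<mu> a = radial_field (u_ss CARD('n) \<mu> a)"

definition in_Lp :: "real \<Rightarrow> (real ^ 'n::finite \<Rightarrow> real ^ 'm::finite) \<Rightarrow> bool"
  where "in_Lp p f \<longleftrightarrow> f \<in> borel_measurable lebesgue \<and> integrable lebesgue (\<lambda>x. norm (f x) powr p)"

definition Lp_norm :: "real \<Rightarrow> (real ^ 'n::finite \<Rightarrow> real ^ 'm::finite) \<Rightarrow> real"
  where "Lp_norm p f = (LINT x|lebesgue. norm (f x) powr p) powr (1 / p)"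

text \<open>The Bochner integral of a non-integrable function is \<open>0\<close>, so membership in \<open>L\<^sup>p\<close> has to be
  required explicitly.\<close>

definition vanishing_initial_data :: "real \<Rightarrow> (real \<Rightarrow> real ^ 'n::finite \<Rightarrow> real ^ 'm::finite) \<Rightarrow> bool"
  where "vanishing_initial_data p u \<longleftrightarrow>
    (\<forall>t>0. in_Lp p (u t)) \<and> ((\<lambda>t. Lp_norm p (u t)) \<longlongrightarrow> 0) (at_right 0)"

text \<open>Forgets the meaningless values at \<open>t \<le> 0\<close>, so that two fields are counted as different
  only if they differ at some positive time.\<close>

definition on_positive_times ::
    "(real \<Rightarrow> real ^ 'n::finite \<Rightarrow> real ^ 'm::finite) \<Rightarrow> real \<times> (real ^ 'n) \<Rightarrow> real ^ 'm"
  where "on_positive_times u = restrict (\<lambda>(t, x). u t x) ({0<..} \<times> UNIV)"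

end

theory Submission
  imports Defs
begin

text \<open>
  The function \<open>F(z) = a + \<integral>\<^sub>z\<^sup>\<infinity> s powr (- n/2) * exp (- s) ds\<close>, evaluated at the similarity variable
  \<open>z = |x|\<^sup>2 / (4 \<mu> t)\<close>, is a positive solution of the heat equation \<open>\<phi>\<^sub>t = \<mu> \<Delta> \<phi>\<close> away from \<open>x = 0\<close>, and
  the field is its Cole--Hopf transform \<open>u = - 2 \<mu> \<nabla> log \<phi>\<close>. The proof does not go through the heat
  equation but through the equivalent form \<open>u = H(z) x / t\<close> with \<open>H = - F' / F\<close>
  (\<open>u_ss_field_eq_profile\<close>). The Burgers system for such a field is a second-order ordinary
  differential equation for \<open>H\<close> (\<open>classical_solution_of_profile_ode\<close>), and this equation follows from
  the Riccati equation that \<open>F'' = - (1 + n / (2 z)) F'\<close> imposes on the logarithmic derivative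
  of \<open>F\<close> (\<open>profile_riccati\<close>).

  Near the origin the size of the field is governed by the competition between \<open>z powr (- n/2)\<close> in the
  numerator of \<open>H\<close> and the divergent integral in its denominator. A lower bound on the integral
  gives \<open>z H(z) \<le> C exp (- z)\<close> (\<open>profile_decay\<close>), that is,
  \<open>|u(t, x)| \<le> (C' / |x|) exp (- |x|\<^sup>2 / (4 \<mu> t))\<close>. The singularity \<open>1 / |x|\<close> has a locally integrable
  \<open>p\<close>-th power exactly when \<open>p < n\<close>, and the Gaussian then forces the \<open>L\<^sup>p\<close> norm to \<open>0\<close> with \<open>t\<close>
  (\<open>vanishing_initial_data_of_gaussian_bound\<close>). An upper bound on the integral gives
  \<open>sqrt z * H(z) \<longrightarrow> \<infinity>\<close> as \<open>z \<longrightarrow> 0\<close> (\<open>profile_blow_up\<close>), hence the unboundedness. Distinct values of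
  \<open>a\<close> give distinct fields, so there are infinitely many.
\<close>

section \<open>The incomplete Gamma function and the similarity profile\<close>

text \<open>The upper incomplete Gamma function \<open>\<Gamma>(1 - \<nu>, z)\<close>, needed at \<open>\<nu> \<ge> 1\<close>, where the
  integral over all of \<open>(0, \<infinity>)\<close> diverges.\<close>

definition gamma_tail :: "real \<Rightarrow> real \<Rightarrow> real"
  where "gamma_tail \<nu> z = (LINT s:{z..}|lborel. s powr (- \<nu>) * exp (- s))"

text \<open>The negative logarithmic derivative \<open>- F' / F\<close> of \<open>F = a + gamma_tail \<nu>\<close>.\<close>

definition profile :: "real \<Rightarrow> real \<Rightarrow> real \<Rightarrow> real"
  where "profile \<nu> a z = z powr (- \<nu>) * exp (- z) / (a + gamma_tail \<nu> z)"

lemma gamma_kernel_set_integrable: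
  fixes \<alpha> :: real
  assumes "\<alpha> < 1"
  shows "set_integrable lborel {0..} (\<lambda>s. s powr (- \<alpha>) * exp (- s))"
    and "(LINT s:{0..}|lborel. s powr (- \<alpha>) * exp (- s)) = Gamma (1 - \<alpha>)"
proof -
  have eq: "(\<lambda>t. t powr (1 - \<alpha> - 1) / exp t) = (\<lambda>s. s powr (- \<alpha>) * exp (- s))"
    by (auto simp: exp_minus field_simps)
  have hi: "((\<lambda>s. s powr (- \<alpha>) * exp (- s)) has_integral Gamma (1 - \<alpha>)) {0..}"
    using Gamma_integral_real[of "1 - \<alpha>"] assms unfolding eq by simp
  then have "(\<lambda>s. s powr (- \<alpha>) * exp (- s)) absolutely_integrable_on {0..}"
    by (intro nonnegative_absolutely_integrable_1) (auto intro: has_integral_integrable)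
  then show *: "set_integrable lborel {0..} (\<lambda>s. s powr (- \<alpha>) * exp (- s))"
    unfolding set_integrable_def by (subst (asm) integrable_completion) simp_all
  show "(LINT s:{0..}|lborel. s powr (- \<alpha>) * exp (- s)) = Gamma (1 - \<alpha>)"
    using set_borel_integral_eq_integral(2)[OF *] hi by (simp add: integral_unique)
qed

text \<open>The comparison exponent \<open>3/4\<close> could be any number in \<open>(1/2, 1)\<close>: below \<open>1\<close> the kernel is
  integrable at \<open>0\<close>, and above \<open>1/2\<close> the resulting bound on the tail is of smaller order than
  \<open>z powr (1/2 - \<nu>)\<close>, which is what makes the field unbounded.\<close>

lemma gamma_tail_kernel_le:
  fixes \<nu> z s :: real
  assumes "\<nu> \<ge> 3/4" "0 < z" "z \<le> s"
  shows "s powr (- \<nu>) * exp (- s) \<le> z powr (3/4 - \<nu>) * (s powr (- (3/4)) * exp (- s))"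
proof -
  have "s powr (- \<nu>) = s powr (3/4 - \<nu>) * s powr (- (3/4))"
    by (simp flip: powr_add)
  also have "\<dots> \<le> z powr (3/4 - \<nu>) * s powr (- (3/4))"
    using assms by (intro mult_right_mono powr_mono2') auto
  finally show ?thesis
    by (simp add: mult_right_mono flip: mult.assoc)
qed

lemma gamma_tail_set_integrable:
  fixes \<nu> z :: real
  assumes "\<nu> \<ge> 3/4" "0 < z"
  shows "set_integrable lborel {z..} (\<lambda>s. s powr (- \<nu>) * exp (- s))"
proof (rule set_integrable_bound)
  show "set_integrable lborel {z..} (\<lambda>s. z powr (3/4 - \<nu>) * (s powr (- (3/4)) * exp (- s)))"
    using assms
    by (intro set_integrable_mult_right set_integrable_subset[OF gamma_kernel_set_integrable(1)]) auto
  show "set_borel_measurable lborel {z..} (\<lambda>s. s powr (- \<nu>) * exp (- s))"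
    unfolding set_borel_measurable_def by measurable
  show "AE s in lborel. s \<in> {z..} \<longrightarrow> norm (s powr (- \<nu>) * exp (- s))
      \<le> norm (z powr (3/4 - \<nu>) * (s powr (- (3/4)) * exp (- s)))"
    using gamma_tail_kernel_le[OF assms] by (auto simp: abs_mult)
qed

lemma gamma_tail_nonneg: "gamma_tail \<nu> z \<ge> 0"
  unfolding gamma_tail_def set_lebesgue_integral_def
  by (intro integral_nonneg_AE) auto

lemma gamma_tail_le:
  fixes \<nu> z :: real
  assumes "\<nu> \<ge> 3/4" "0 < z"
  shows "gamma_tail \<nu> z \<le> z powr (3/4 - \<nu>) * Gamma (1/4)"
proof -
  note int = gamma_kernel_set_integrable[of "3/4", simplified]
  have sub: "set_integrable lborel {z..} (\<lambda>s. s powr (- (3/4)) * exp (- s))"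
    using assms by (intro set_integrable_subset[OF int(1)]) auto
  have "gamma_tail \<nu> z \<le> (LINT s:{z..}|lborel. z powr (3/4 - \<nu>) * (s powr (- (3/4)) * exp (- s)))"
    unfolding gamma_tail_def
    using sub gamma_tail_kernel_le[OF assms]
    by (intro set_integral_mono gamma_tail_set_integrable set_integrable_mult_right assms) auto
  also have "\<dots> = z powr (3/4 - \<nu>) * (LINT s:{z..}|lborel. s powr (- (3/4)) * exp (- s))"
    by simp
  also have "(LINT s:{z..}|lborel. s powr (- (3/4)) * exp (- s))
      \<le> (LINT s:{0..}|lborel. s powr (- (3/4)) * exp (- s))"
    using sub int(1) assms unfolding set_lebesgue_integral_def set_integrable_def
    by (intro integral_mono) (auto simp: indicator_def)
  finally show ?thesis
    using int(2) by (simp add: mult_left_mono)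
qed

lemma gamma_tail_ge:
  fixes \<nu> z :: real
  assumes "\<nu> \<ge> 3/4" "0 < z"
  shows "gamma_tail \<nu> z \<ge> z * ((2 * z) powr (- \<nu>) * exp (- (2 * z)))"
proof -
  let ?c = "(2 * z) powr (- \<nu>) * exp (- (2 * z))"
  have le: "?c \<le> s powr (- \<nu>) * exp (- s)" if "z \<le> s" "s \<le> 2 * z" for s
    using that assms by (intro mult_mono powr_mono2') auto
  have "z * ?c = (LINT s:{z..2*z}|lborel. ?c)"
    using assms by (simp add: set_lebesgue_integral_def)
  also have "\<dots> \<le> gamma_tail \<nu> z"
    unfolding gamma_tail_def set_lebesgue_integral_def
  proof (rule integral_mono)
    show "integrable lborel (\<lambda>s. indicat_real {z..2*z} s *\<^sub>R ?c)"
      by (intro integrable_scaleR_left integrable_real_indicator) (use assms in auto)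
    show "integrable lborel (\<lambda>s. indicat_real {z..} s *\<^sub>R (s powr (- \<nu>) * exp (- s)))"
      using gamma_tail_set_integrable[OF assms] by (simp add: set_integrable_def)
  qed (use le in \<open>auto simp: indicator_def\<close>)
  finally show ?thesis .
qed

lemma gamma_tail_has_derivative:
  fixes \<nu> z :: real
  assumes "\<nu> \<ge> 3/4" "0 < z"
  shows "(gamma_tail \<nu> has_real_derivative - (z powr (- \<nu>) * exp (- z))) (at z)"
proof -
  define f where "f = (\<lambda>s. s powr (- \<nu>) * exp (- s) :: real)"
  have split: "gamma_tail \<nu> y = integral {y..2*z} f + gamma_tail \<nu> (2 * z)"
    if y: "y \<in> {z/2..2*z}" for y
  proof -
    have "set_integrable lborel {y..} f"
      using gamma_tail_set_integrable[OF assms(1), of y] y assms by (auto simp: f_def)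
    then have int: "f integrable_on {y..}" "gamma_tail \<nu> y = integral {y..} f"
      using set_borel_integral_eq_integral[of "{y..}" f]
      by (auto simp: gamma_tail_def f_def)
    have "set_integrable lborel {2*z..} f"
      using gamma_tail_set_integrable[OF assms(1), of "2*z"] assms by (auto simp: f_def)
    then have int2: "f integrable_on {2*z..}" "gamma_tail \<nu> (2*z) = integral {2*z..} f"
      using set_borel_integral_eq_integral[of "{2*z..}" f]
      by (auto simp: gamma_tail_def f_def)
    have int3: "f integrable_on {y..2*z}"
      by (rule integrable_on_subinterval[OF int(1)]) auto
    have un: "{y..} = {y..2*z} \<union> {2*z..}" "{y..2*z} \<inter> {2*z..} = {2*z}" using y by auto
    show ?thesis
      unfolding int int2 un(1) by (rule integral_Un[OF int3 int2(1)]) (simp only: un(2) negligible_sing)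
  qed
  have "continuous_on {z/2..2*z} f"
    unfolding f_def using assms by (intro continuous_intros) auto
  then have "((\<lambda>y. integral {y..2*z} f) has_real_derivative - f z) (at z within {z/2..2*z})"
    using assms by (intro integral_has_real_derivative') auto
  then have "((\<lambda>y. integral {y..2*z} f + gamma_tail \<nu> (2*z)) has_real_derivative - f z)
      (at z within {z/2..2*z})"
    by (auto intro!: derivative_eq_intros)
  moreover have "at z within {z/2..2*z} = at z"
    using assms by (intro at_within_interior) (auto simp: )
  ultimately have "((\<lambda>y. integral {y..2*z} f + gamma_tail \<nu> (2*z)) has_real_derivative - f z) (at z)"
    by simp
  then have "(gamma_tail \<nu> has_real_derivative - f z) (at z)"
  proof (rule has_field_derivative_transform_within_open)
    show "integral {y..2*z} f + gamma_tail \<nu> (2*z) = gamma_tail \<nu> y" if "y \<in> {z/2<..<2*z}" for y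
      using split[of y] that by simp
  qed (use assms in auto)
  then show ?thesis
    by (simp add: f_def)
qed

lemma profile_pos:
  assumes "a > 0" "z > 0"
  shows "profile \<nu> a z > 0"
  using assms gamma_tail_nonneg[of \<nu> z] by (auto simp: profile_def intro!: divide_pos_pos add_pos_nonneg)

lemma riccati_quotient_identity:
  fixes P X T z \<nu> :: real
  assumes "T \<noteq> 0" "z \<noteq> 0"
  shows "((- \<nu> * (P / z) * X - P * X) * T + (P * X) * (P * X)) / T\<^sup>2
    = (P * X / T)\<^sup>2 - P * X / T - \<nu> * (P * X / T) / z"
  using assms by (simp add: field_simps power2_eq_square)

text \<open>With \<open>F = a + gamma_tail \<nu>\<close> one has \<open>F'' / F' = - 1 - \<nu> / z\<close>, so \<open>h = - F' / F\<close> satisfies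
  \<open>h' = h\<^sup>2 - F'' / F = h\<^sup>2 + h F'' / F'\<close>, a Riccati equation.\<close>

lemma profile_riccati:
  fixes \<nu> a z :: real
  assumes "\<nu> \<ge> 3/4" "a > 0" "z > 0"
  defines "h \<equiv> profile \<nu> a z"
  shows "(profile \<nu> a has_real_derivative h\<^sup>2 - h - \<nu> * h / z) (at z)"
proof -
  have pos: "a + gamma_tail \<nu> z > 0"
    using assms gamma_tail_nonneg[of \<nu> z] by auto
  have zp: "z powr (- \<nu> - 1) = z powr (- \<nu>) / z"
    using assms by (simp add: powr_diff)
  have h: "h * (a + gamma_tail \<nu> z) = z powr (- \<nu>) * exp (- z)"
    using pos by (simp add: h_def profile_def)
  have "(profile \<nu> a has_real_derivative
     ((- \<nu> * z powr (- \<nu> - 1) * exp (- z) - z powr (- \<nu>) * exp (- z)) * (a + gamma_tail \<nu> z)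
        + (z powr (- \<nu>) * exp (- z)) * (z powr (- \<nu>) * exp (- z)))
      / (a + gamma_tail \<nu> z)\<^sup>2) (at z)"
    unfolding profile_def[abs_def] using assms pos
    by (auto intro!: derivative_eq_intros gamma_tail_has_derivative
         simp: power2_eq_square zp field_simps)
  also have "((- \<nu> * z powr (- \<nu> - 1) * exp (- z) - z powr (- \<nu>) * exp (- z)) * (a + gamma_tail \<nu> z)
        + (z powr (- \<nu>) * exp (- z)) * (z powr (- \<nu>) * exp (- z)))
      / (a + gamma_tail \<nu> z)\<^sup>2 = h\<^sup>2 - h - \<nu> * h / z"
    unfolding zp h_def profile_def using pos assms(3)
    by (intro riccati_quotient_identity) auto
  finally show ?thesis .
qed

text \<open>For small \<open>z\<close> the singularity \<open>z powr (- \<nu>)\<close> of the numerator is compensated, up to one factor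
  \<open>1 / z\<close>, by the growth of the tail, of which the part over \<open>[z, 2z]\<close> suffices; for large \<open>z\<close>
  the denominator is bounded below by \<open>a\<close>.\<close>

lemma profile_decay:
  fixes \<nu> a z :: real
  assumes "\<nu> \<ge> 1" "a > 0" "z > 0"
  shows "z * profile \<nu> a z \<le> max (2 powr \<nu> * exp 2) (1 / a) * exp (- z)"
proof (cases "z \<le> 1")
  case True
  have "z * profile \<nu> a z * (z * ((2 * z) powr (- \<nu>) * exp (- (2 * z))))
      \<le> z * profile \<nu> a z * (a + gamma_tail \<nu> z)"
    using gamma_tail_ge[of \<nu> z] assms profile_pos[OF assms(2,3)]
    by (intro mult_left_mono) (auto intro: less_imp_le)
  also have "\<dots> = z * (z powr (- \<nu>) * exp (- z))"
    using assms gamma_tail_nonneg[of \<nu> z] by (simp add: profile_def)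
  also have "\<dots> = (2 powr \<nu> * exp (2 * z) * exp (- z)) * (z * ((2 * z) powr (- \<nu>) * exp (- (2 * z))))"
    using assms by (simp add: powr_mult powr_minus exp_minus field_simps)
  finally have "z * profile \<nu> a z \<le> 2 powr \<nu> * exp (2 * z) * exp (- z)"
    using assms by (subst (asm) mult_le_cancel_right) auto
  also have "\<dots> \<le> 2 powr \<nu> * exp 2 * exp (- z)"
    using True by simp
  also have "\<dots> \<le> max (2 powr \<nu> * exp 2) (1 / a) * exp (- z)"
    by (intro mult_right_mono) auto
  finally show ?thesis .
next
  case False
  have "z * z powr (- \<nu>) = z powr (1 - \<nu>)"
    using assms by (simp add: powr_diff powr_minus field_simps)
  also have "\<dots> \<le> z powr 0"
    using assms False by (intro powr_mono) auto
  finally have le1: "z * z powr (- \<nu>) \<le> 1"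
    using assms by simp
  have "z * profile \<nu> a z = (z * z powr (- \<nu>)) * exp (- z) / (a + gamma_tail \<nu> z)"
    by (simp add: profile_def)
  also have "\<dots> \<le> (z * z powr (- \<nu>)) * exp (- z) / a"
    using assms gamma_tail_nonneg[of \<nu> z] by (intro divide_left_mono mult_pos_pos) auto
  also have "\<dots> \<le> 1 * exp (- z) / a"
    using assms le1 by (intro divide_right_mono mult_right_mono) auto
  also have "\<dots> \<le> max (2 powr \<nu> * exp 2) (1 / a) * exp (- z)"
    using mult_right_mono[of "1/a" "max (2 powr \<nu> * exp 2) (1 / a)" "exp (- z)"] by simp
  finally show ?thesis .
qed

text \<open>The growth of the tail does not compensate the whole singularity: \<open>sqrt z * profile \<nu> a z\<close>,
  which is proportional to the length of the field, still blows up as \<open>z \<longrightarrow> 0\<close>.\<close>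

lemma profile_blow_up:
  fixes \<nu> a z :: real
  assumes "\<nu> \<ge> 1" "a > 0" "0 < z" "z \<le> 1"
  shows "sqrt z * profile \<nu> a z \<ge> exp (- 1) / (a + Gamma (1/4)) * z powr (- (1/4))"
proof -
  let ?T = "a + gamma_tail \<nu> z"
  have T: "?T > 0"
    using assms gamma_tail_nonneg[of \<nu> z] by auto
  have G: "Gamma (1/4 :: real) > 0"
    by (rule Gamma_real_pos) simp
  have "z powr (\<nu> - 3/4) * ?T \<le> z powr (\<nu> - 3/4) * (a + z powr (3/4 - \<nu>) * Gamma (1/4))"
    using gamma_tail_le[of \<nu> z] assms by (intro mult_left_mono add_left_mono) auto
  also have "\<dots> = z powr (\<nu> - 3/4) * a + Gamma (1/4)"
    using assms by (simp add: algebra_simps flip: powr_add)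
  also have "\<dots> \<le> 1 * a + Gamma (1/4)"
    using assms by (intro add_right_mono mult_right_mono powr_le1) auto
  finally have le: "z powr (\<nu> - 3/4) * ?T \<le> a + Gamma (1/4)"
    by simp
  have "exp (- 1) / (a + Gamma (1/4)) * z powr (- (1/4))
      \<le> exp (- z) / (z powr (\<nu> - 3/4) * ?T) * z powr (- (1/4))"
    using assms T G le by (intro mult_right_mono frac_le mult_pos_pos) auto
  also have "\<dots> = z powr (- (\<nu> - 3/4)) * z powr (- (1/4)) * exp (- z) / ?T"
    using T assms by (simp add: powr_minus field_simps)
  also have "z powr (- (\<nu> - 3/4)) * z powr (- (1/4)) = sqrt z * z powr (- \<nu>)"
    using assms by (simp add: powr_half_sqrt[symmetric] flip: powr_add)
  finally show ?thesis
    by (simp add: profile_def)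
qed

section \<open>Reduction of the Burgers system to an ordinary differential equation\<close>

lemma partial_deriv_eqI:
  assumes "(f has_derivative D) (at x)"
  shows "partial_deriv i f x = D (axis i 1)"
  using frechet_derivative_at[OF assms] by (simp add: partial_deriv_def)

lemma has_derivative_quadratic_comp:
  fixes x :: "'a::real_inner" and H :: "real \<Rightarrow> real"
  assumes "(H has_real_derivative D) (at (x \<bullet> x / c))"
  shows "((\<lambda>y. H (y \<bullet> y / c)) has_derivative (\<lambda>v. D * (2 * (x \<bullet> v) / c))) (at x)"
proof -
  have "((\<lambda>y. y \<bullet> y / c) has_derivative (\<lambda>v. 2 * (x \<bullet> v) / c)) (at x)"
    by (auto intro!: derivative_eq_intros simp: inner_commute divide_inverse algebra_simps)
  from has_derivative_compose[OF this, of H "(*) D"] assms show ?thesis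
    by (simp add: has_field_derivative_def)
qed

text \<open>The Laplacian is defined through iterated partial derivatives of the components. The inner
  partial derivative agrees with the component of the vector-valued one only where \<open>f\<close> is
  differentiable, so differentiability is needed in a neighbourhood of \<open>x\<close>.\<close>

lemma vec_laplacian_eq_sum:
  fixes f :: "real ^ 'n::finite \<Rightarrow> real ^ 'm::finite"
  assumes "open S" "x \<in> S"
    and "\<And>y. y \<in> S \<Longrightarrow> f differentiable (at y)"
    and "\<And>i. partial_deriv i f differentiable (at x)"
  shows "vec_laplacian f x = (\<Sum>i\<in>UNIV. partial_deriv i (partial_deriv i f) x)"
proof -
  have comp: "partial_deriv i (\<lambda>y. g y $ j) y = partial_deriv i g y $ j"
    if g: "g differentiable (at y)" for i j y and g :: "real ^ 'n::finite \<Rightarrow> real ^ 'm::finite"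
  proof -
    obtain D where D: "(g has_derivative D) (at y)"
      using g by (auto simp: differentiable_def)
    show ?thesis
      using partial_deriv_eqI[OF D] partial_deriv_eqI[OF bounded_linear.has_derivative[OF bounded_linear_vec_nth D]] by simp
  qed
  have "partial_deriv i (partial_deriv i (\<lambda>y. f y $ j)) x = partial_deriv i (partial_deriv i f) x $ j" for i j
  proof -
    obtain D where D: "(partial_deriv i f has_derivative D) (at x)"
      using assms(4)[of i] by (auto simp: differentiable_def)
    have "(partial_deriv i (\<lambda>y. f y $ j) has_derivative (\<lambda>v. D v $ j)) (at x)"
      by (rule has_derivative_transform_within_open
            [OF bounded_linear.has_derivative[OF bounded_linear_vec_nth D] assms(1,2)])
        (simp add: comp assms(3))
    then show ?thesis
      using partial_deriv_eqI D by metis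
  qed
  then show ?thesis
    by (simp add: vec_eq_iff vec_laplacian_def laplacian_def)
qed

lemma convective_eq:
  fixes f :: "real ^ 'n::finite \<Rightarrow> real ^ 'n"
  assumes "(f has_derivative D) (at x)"
  shows "convective f x = D (f x)"
proof -
  have "(f has_derivative (\<lambda>h. jacobian f (at x) *v h)) (at x)"
    using assms jacobian_works differentiableI by blast
  then show ?thesis
    using has_derivative_unique[OF assms] by (metis convective_def)
qed

text \<open>For a field of the form \<open>u = H(z) x / t\<close> with \<open>z = |x|\<^sup>2 / (4 \<mu> t)\<close> every term of the equation is a
  multiple of \<open>x / t\<^sup>2\<close>. The time derivative contributes \<open>- H - z H'\<close>, convection
  \<open>H\<^sup>2 + 2 z H H'\<close>, and \<open>\<mu> \<Delta> u\<close> contributes \<open>(n/2 + 1) H' + z H''\<close>, so the system reduces to one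
  ordinary differential equation for \<open>H\<close>.\<close>

lemma classical_solution_of_profile_ode:
  fixes u :: "real \<Rightarrow> real ^ 'n::finite \<Rightarrow> real ^ 'n" and H H1 H2 :: "real \<Rightarrow> real"
  assumes \<mu>: "\<mu> > 0"
    and H: "\<And>z. z > 0 \<Longrightarrow> (H has_real_derivative H1 z) (at z)"
    and H1: "\<And>z. z > 0 \<Longrightarrow> (H1 has_real_derivative H2 z) (at z)"
    and H2: "continuous_on {0<..} H2"
    and ode: "\<And>z. z > 0 \<Longrightarrow>
      - H z - z * H1 z + (H z)\<^sup>2 + 2 * z * H z * H1 z = (CARD('n) / 2 + 1) * H1 z + z * H2 z"
    and u: "\<And>t x. t > 0 \<Longrightarrow> x \<noteq> 0 \<Longrightarrow> u t x = (H (x \<bullet> x / (4 * \<mu> * t)) / t) *\<^sub>R x"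
  shows "classical_solution_on \<mu> ({0<..} \<times> (UNIV - {0})) u"
proof -
  define z where "z = (\<lambda>t (x :: real ^ 'n). x \<bullet> x / (4 * \<mu> * t))"
  have zpos: "z t x > 0" if "t > 0" "x \<noteq> 0" for t x
    using that \<mu> by (simp add: z_def)
  \<comment> \<open>The spatial gradient of \<open>z\<close> is \<open>x / c t\<close>.\<close>
  define c where "c = (\<lambda>t. 2 * \<mu> * t)"
  have comp: "((\<lambda>y. G (z t y)) has_derivative (\<lambda>v. G' (z t x) * (x \<bullet> v) / c t)) (at x)"
    if "\<And>z. z > 0 \<Longrightarrow> (G has_real_derivative G' z) (at z)" "t > 0" "x \<noteq> 0" for G G' t x
    using has_derivative_quadratic_comp[of G "G' (z t x)" x "4 * \<mu> * t"] that zpos[of t x]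
    by (simp add: z_def c_def mult.assoc)
  have D0: "(u t has_derivative
        (\<lambda>v. (H (z t x) / t) *\<^sub>R v + (H1 (z t x) * (x \<bullet> v) / c t / t) *\<^sub>R x)) (at x)"
    if "t > 0" "x \<noteq> 0" for t x
  proof -
    have "((\<lambda>y. (H (z t y) / t) *\<^sub>R y) has_derivative
        (\<lambda>v. (H (z t x) / t) *\<^sub>R v + (H1 (z t x) * (x \<bullet> v) / c t / t) *\<^sub>R x)) (at x)"
      using that by (auto intro!: derivative_eq_intros comp H simp: divide_inverse)
    then show ?thesis
      by (rule has_derivative_transform_within_open[of _ _ _ UNIV "- {0}"])
         (use that u in \<open>auto simp: z_def\<close>)
  qed
  define P where "P = (\<lambda>i t x. (H (z t x) / t) *\<^sub>R axis i (1::real) + (H1 (z t x) * x $ i / c t / t) *\<^sub>R x)"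
  have P: "partial_deriv i (u t) x = P i t x" if "t > 0" "x \<noteq> 0" for i t x
    using partial_deriv_eqI[OF D0[OF that], of i] by (simp add: P_def inner_axis)
  have D1: "(partial_deriv i (u t) has_derivative
        (\<lambda>v. (H1 (z t x) * (x \<bullet> v) / c t / t) *\<^sub>R axis i 1
           + (H1 (z t x) * x $ i / c t / t) *\<^sub>R v
           + ((H2 (z t x) * (x \<bullet> v) / c t * x $ i + H1 (z t x) * v $ i) / c t / t) *\<^sub>R x)) (at x)"
    if "t > 0" "x \<noteq> 0" for i t x
  proof -
    have "(P i t has_derivative
        (\<lambda>v. (H1 (z t x) * (x \<bullet> v) / c t / t) *\<^sub>R axis i 1
           + (H1 (z t x) * x $ i / c t / t) *\<^sub>R v
           + ((H2 (z t x) * (x \<bullet> v) / c t * x $ i + H1 (z t x) * v $ i) / c t / t) *\<^sub>R x)) (at x)"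
      unfolding P_def using that
      by (auto intro!: derivative_eq_intros comp H H1 bounded_linear.has_derivative[OF bounded_linear_vec_nth] simp: divide_inverse algebra_simps fun_eq_iff)
    then show ?thesis
      by (rule has_derivative_transform_within_open[of _ _ _ UNIV "- {0}"])
         (use that P in \<open>auto\<close>)
  qed
  note diff = differentiableI[OF D0] differentiableI[OF D1]
  define PP where "PP = (\<lambda>k i t x. (H1 (z t x) * x $ k / c t / t) *\<^sub>R axis i (1::real)
           + (H1 (z t x) * x $ i / c t / t) *\<^sub>R axis k 1
           + ((H2 (z t x) * x $ k / c t * x $ i + H1 (z t x) * axis k 1 $ i) / c t / t) *\<^sub>R x)"
  have PP: "partial_deriv k (partial_deriv i (u t)) x = PP k i t x"
    if "t > 0" "x \<noteq> 0" for k i t x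
    using partial_deriv_eqI[OF D1[OF that], of k i] by (simp add: PP_def inner_axis)
  define U where "U = (\<lambda>t x. - ((H (z t x) + z t x * H1 (z t x)) / t\<^sup>2) *\<^sub>R x)"
  have DT: "((\<lambda>s. u s x) has_vector_derivative U t x) (at t)"
    if "t > 0" "x \<noteq> 0" for t x
  proof -
    have z': "((\<lambda>s. z s x) has_real_derivative - z t x / t) (at t)"
      using that \<mu> unfolding z_def
      by (auto intro!: derivative_eq_intros simp: field_simps power2_eq_square)
    have "((\<lambda>s. H (z s x)) has_real_derivative H1 (z t x) * (- z t x / t)) (at t)"
      by (rule DERIV_chain2[OF H z']) (use zpos that in auto)
    then have "((\<lambda>s. H (z s x) / s) has_real_derivative - ((H (z t x) + z t x * H1 (z t x)) / t\<^sup>2)) (at t)"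
      using that by (auto intro!: derivative_eq_intros simp: field_simps power2_eq_square)
    from has_vector_derivative_scaleR[OF this has_vector_derivative_const[of x]]
    have "((\<lambda>s. (H (z s x) / s) *\<^sub>R x) has_vector_derivative U t x) (at t)"
      by (simp add: U_def)
    then show ?thesis
      by (rule has_vector_derivative_transform_within_open[of _ _ _ "{0<..}"])
         (use that u in \<open>auto simp: z_def\<close>)
  qed
  let ?Q = "{0<..} \<times> (UNIV - {0 :: real ^ 'n})"
  have contz: "continuous_on ?Q (\<lambda>p. z (fst p) (snd p))"
    unfolding z_def using \<mu> by (intro continuous_intros) auto
  have cont: "continuous_on ?Q (\<lambda>p. G (z (fst p) (snd p)))" if "continuous_on {0<..} G" for G :: "real \<Rightarrow> real"
    by (rule continuous_on_compose2[OF that contz]) (auto intro: zpos)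
  have contH: "continuous_on {0<..} H"
    by (meson DERIV_continuous H continuous_at_imp_continuous_on greaterThan_iff)
  have contH1: "continuous_on {0<..} H1"
    by (meson DERIV_continuous H1 continuous_at_imp_continuous_on greaterThan_iff)
  have "C12_on ?Q u"
    unfolding C12_on_def
  proof (intro conjI allI)
    show "\<forall>(t, x)\<in>?Q. (\<lambda>s. u s x) differentiable at t \<and> u t differentiable at x \<and>
        (\<forall>i. partial_deriv i (u t) differentiable at x)"
      using differentiableI_vector[OF DT] diff by auto
    have "continuous_on ?Q (\<lambda>p. (H (z (fst p) (snd p)) / fst p) *\<^sub>R snd p)"
      by (intro continuous_intros cont contH) auto
    then show "continuous_on ?Q (\<lambda>(t, x). u t x)"
      by (rule continuous_on_eq) (simp add: u z_def split_def mem_Times_iff)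
    have "continuous_on ?Q (\<lambda>p. U (fst p) (snd p))"
      unfolding U_def by (intro continuous_intros cont contz contH contH1) auto
    then show "continuous_on ?Q (\<lambda>(t, x). time_deriv u t x)"
      by (rule continuous_on_eq) (simp add: time_deriv_def vector_derivative_at[OF DT] split_def mem_Times_iff)
    show "continuous_on ?Q (\<lambda>(t, x). partial_deriv i (u t) x)" for i
    proof -
      have "continuous_on ?Q (\<lambda>p. P i (fst p) (snd p))"
        unfolding P_def c_def using \<mu> by (intro continuous_intros cont contH contH1) auto
      then show ?thesis
        by (rule continuous_on_eq) (simp add: P split_def mem_Times_iff)
    qed
    show "continuous_on ?Q (\<lambda>(t, x). partial_deriv i (partial_deriv j (u t)) x)" for i j
    proof -
      have "continuous_on ?Q (\<lambda>p. PP i j (fst p) (snd p))"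
        unfolding PP_def c_def using \<mu> by (intro continuous_intros cont contH1 H2) auto
      then show ?thesis
        by (rule continuous_on_eq) (simp add: PP split_def mem_Times_iff)
    qed
  qed
  moreover have "time_deriv u t x + convective (u t) x = \<mu> *\<^sub>R vec_laplacian (u t) x"
    if t: "t > 0" and x: "x \<noteq> 0" for t x
  proof -
    have basis: "(\<Sum>i\<in>UNIV. x $ i *\<^sub>R axis i (1::real)) = x"
      using basis_expansion[of x] by (simp add: scalar_mult_eq_scaleR)
    have square: "(\<Sum>i\<in>UNIV. x $ i * x $ i) = x \<bullet> x"
      by (simp add: inner_vec_def)
    let ?h = "H (z t x)" and ?h1 = "H1 (z t x)" and ?h2 = "H2 (z t x)"
    have xx: "x \<bullet> x = 4 * \<mu> * t * z t x"
      using t \<mu> by (simp add: z_def)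
    have conv: "convective (u t) x = ((?h\<^sup>2 + 2 * z t x * ?h * ?h1) / t\<^sup>2) *\<^sub>R x"
      unfolding convective_eq[OF D0[OF t x]] using u[OF t x] t \<mu>
      by (simp add: xx c_def field_simps power2_eq_square flip: z_def scaleR_add_left)
    have "vec_laplacian (u t) x = (\<Sum>i\<in>UNIV. PP i i t x)"
      using vec_laplacian_eq_sum[of "- {0}" x "u t"] diff t x PP by (simp add: open_Compl)
    also have "\<dots> = (2 * ?h1 / c t / t) *\<^sub>R (\<Sum>i\<in>UNIV. x $ i *\<^sub>R axis i (1::real))
        + ((?h2 / c t * (\<Sum>i\<in>UNIV. x $ i * x $ i) + CARD('n) * ?h1) / c t / t) *\<^sub>R x"
    proof -
      have "PP i i t x = (2 * ?h1 / c t / t) *\<^sub>R (x $ i *\<^sub>R axis i (1::real))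
          + ((?h2 / c t * (x $ i * x $ i) + ?h1) / c t / t) *\<^sub>R x" for i
      proof -
        have "(?h1 * x $ i / c t / t) *\<^sub>R axis i (1::real) + (?h1 * x $ i / c t / t) *\<^sub>R axis i 1
            = (2 * ?h1 / c t / t) *\<^sub>R (x $ i *\<^sub>R axis i 1)"
          by (simp add: algebra_simps flip: scaleR_add_left)
        then show ?thesis
          by (simp add: PP_def mult.assoc)
      qed
      then show ?thesis
        by (simp add: sum.distrib scaleR_sum_right sum_distrib_left
            flip: scaleR_sum_left sum_divide_distrib)
    qed
    also have "\<dots> = ((2 * ?h1 + CARD('n) * ?h1 + 2 * z t x * ?h2) / c t / t) *\<^sub>R x"
      unfolding basis square xx using t \<mu>
      by (simp add: c_def field_simps flip: scaleR_add_left)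
    finally have lap: "vec_laplacian (u t) x = \<dots>" .
    have "- ((?h + z t x * ?h1) / t\<^sup>2) + (?h\<^sup>2 + 2 * z t x * ?h * ?h1) / t\<^sup>2
        = (- ?h - z t x * ?h1 + ?h\<^sup>2 + 2 * z t x * ?h * ?h1) / t\<^sup>2"
      by (simp add: diff_divide_distrib add_divide_distrib)
    also have "\<dots> = \<mu> * ((2 * ?h1 + CARD('n) * ?h1 + 2 * z t x * ?h2) / c t / t)"
      unfolding ode[OF zpos[OF t x]] using t \<mu>
      by (simp add: c_def field_simps power2_eq_square)
    finally show ?thesis
      unfolding lap conv time_deriv_def vector_derivative_at[OF DT[OF t x]] U_def
        scaleR_scaleR scaleR_add_left[symmetric]
      by (rule arg_cong)
  qed
  ultimately show ?thesis
    by (auto simp: classical_solution_on_def)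
qed

section \<open>Lebesgue norms of fields with an inverse-distance singularity\<close>

lemma gamma_kernel_abs_integrable:
  fixes \<alpha> :: real
  assumes "\<alpha> < 1"
  shows "integrable lborel (\<lambda>s. \<bar>s\<bar> powr (- \<alpha>) * exp (- \<bar>s\<bar>))"
proof -
  define k where "k = (\<lambda>s. indicator {0..} s *\<^sub>R (s powr (- \<alpha>) * exp (- s)) :: real)"
  have k: "integrable lborel k"
    using gamma_kernel_set_integrable(1)[OF assms] by (simp add: k_def set_integrable_def)
  moreover have "integrable lborel (\<lambda>s. k (- s))"
    using lborel_integrable_real_affine[OF k, of "-1" 0] by simp
  ultimately have "integrable lborel (\<lambda>s. k s + k (- s))"
    by (rule Bochner_Integration.integrable_add)
  also have "(\<lambda>s. k s + k (- s)) = (\<lambda>s. \<bar>s\<bar> powr (- \<alpha>) * exp (- \<bar>s\<bar>))"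
    by (auto simp: k_def indicator_def abs_if)
  finally show ?thesis .
qed

text \<open>Tonelli for a product of functions of the single coordinates.\<close>

lemma integrable_product_lborel:
  fixes h :: "real \<Rightarrow> real"
  assumes "integrable lborel h" "\<And>s. h s \<ge> 0"
  shows "integrable lborel (\<lambda>x :: 'a::euclidean_space. \<Prod>b\<in>Basis. h (x \<bullet> b))"
proof (rule integrableI_nonneg)
  have [measurable]: "h \<in> borel_measurable borel"
    using assms(1) by (simp add: integrable_iff_bounded)
  show "(\<lambda>x :: 'a. \<Prod>b\<in>Basis. h (x \<bullet> b)) \<in> borel_measurable lborel"
    by measurable
  have "(\<integral>\<^sup>+ x. ennreal (\<Prod>b\<in>Basis. h (x \<bullet> b)) \<partial>(lborel :: 'a measure))
      = (\<integral>\<^sup>+ x. (\<Prod>b\<in>Basis. ennreal (h (x \<bullet> b))) \<partial>(lborel :: 'a measure))"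
    by (simp add: prod_ennreal assms(2))
  also have "\<dots> = (\<Prod>b\<in>(Basis :: 'a set). \<integral>\<^sup>+ s. ennreal (h s) \<partial>lborel)"
    by (rule nn_integral_lborel_prod) auto
  also have "\<dots> < \<infinity>"
    using assms by (auto simp: integrable_iff_bounded power_less_top_ennreal)
  finally show "(\<integral>\<^sup>+ x. ennreal (\<Prod>b\<in>Basis. h (x \<bullet> b)) \<partial>(lborel :: 'a measure)) < \<infinity>" .
qed (auto intro!: prod_nonneg assms(2))

text \<open>Polar coordinates are avoided: \<open>norm x\<close> dominates every coordinate and the left-hand side is the
  \<open>n\<close>-th power of a decreasing function of \<open>norm x\<close>, so it is at most the product over the
  coordinates of \<open>\<bar>s\<bar> powr (- q/n) * exp (- \<bar>s\<bar>)\<close>, whose exponent satisfies \<open>q/n < 1\<close>.\<close>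

lemma norm_powr_exp_integrable:
  fixes q :: real
  assumes "0 \<le> q" "q < DIM('a::euclidean_space)"
  shows "integrable lborel (\<lambda>x :: 'a. norm x powr (- q) * exp (- (DIM('a) * norm x)))"
proof (rule Bochner_Integration.integrable_bound)
  define h where "h = (\<lambda>s. \<bar>s\<bar> powr (- (q / DIM('a))) * exp (- \<bar>s\<bar>) :: real)"
  have q: "q / DIM('a) \<ge> 0" "q / DIM('a) < 1"
    using assms by (auto simp: field_simps)
  show "integrable lborel (\<lambda>x :: 'a. \<Prod>b\<in>Basis. h (x \<bullet> b))"
    unfolding h_def by (intro integrable_product_lborel gamma_kernel_abs_integrable q) auto
  show "(\<lambda>x :: 'a. norm x powr (- q) * exp (- (DIM('a) * norm x))) \<in> borel_measurable lborel"
    by measurable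
  \<comment> \<open>On the coordinate hyperplanes the comparison fails, since \<open>0 powr (- q/n) = 0\<close>.\<close>
  have "AE x :: 'a in lborel. \<forall>b\<in>Basis. x \<bullet> b \<noteq> 0"
    by (intro AE_finite_allI AE_lborel_inner_neq) auto
  then show "AE x :: 'a in lborel. norm (norm x powr (- q) * exp (- (DIM('a) * norm x)))
      \<le> norm (\<Prod>b\<in>Basis. h (x \<bullet> b))"
  proof eventually_elim
    case (elim x)
    then have "x \<noteq> 0"
      using nonempty_Basis by fastforce
    have "norm x powr (- q) * exp (- (DIM('a) * norm x)) = (\<Prod>b\<in>(Basis :: 'a set). h (norm x))"
    proof -
      have "norm x powr (- q) = (norm x powr (- (q / DIM('a)))) ^ DIM('a)"
        using \<open>x \<noteq> 0\<close> by (subst powr_power) auto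
      then show ?thesis
        by (simp add: h_def power_mult_distrib exp_of_nat_mult[symmetric])
    qed
    also have "\<dots> \<le> (\<Prod>b\<in>Basis. h (x \<bullet> b))"
      using elim q unfolding h_def
      by (intro prod_mono conjI mult_mono powr_mono2') (auto simp: Basis_le_norm)
    finally show ?case
      by (simp add: h_def prod_nonneg)
  qed
qed

lemma powr_le_exp:
  fixes y :: real
  assumes "y \<ge> 0" "0 \<le> \<beta>" "\<beta> \<le> 1"
  shows "y powr \<beta> \<le> exp y"
proof (cases "y \<le> 1")
  case True
  then have "y powr \<beta> \<le> 1"
    using assms by (intro powr_le1) auto
  also have "\<dots> \<le> exp y"
    using assms by simp
  finally show ?thesis .
next
  case False
  then have "y powr \<beta> \<le> y powr 1"
    using assms by (intro powr_mono) auto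
  also have "\<dots> \<le> exp y"
    using False exp_ge_add_one_self[of y] by (subst powr_one) linarith+
  finally show ?thesis .
qed

text \<open>A small part \<open>2 \<beta>\<close> of the available room in the exponent of \<open>r\<close> is traded for the factor
  \<open>t powr \<beta>\<close>. Half of the Gaussian pays for this, the other half leaves the decay
  \<open>exp (- N r)\<close>, with a constant that stays bounded as \<open>t \<longrightarrow> 0\<close>.\<close>

lemma gaussian_singularity_bound:
  fixes C k p \<beta> r t w N :: real
  assumes "k > 0" "t > 0" "r > 0" "p \<ge> 1" "0 \<le> \<beta>" "\<beta> \<le> 1" "w \<ge> 0" "C \<ge> 0"
    and w: "w \<le> C / r * exp (- (r\<^sup>2 / (k * t)))"
  shows "w powr p \<le> C powr p * (2 * k * t) powr \<beta> * exp (N\<^sup>2 * k * t / 2)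
    * (r powr (- (p + 2 * \<beta>)) * exp (- (N * r)))"
proof -
  define y where "y = r\<^sup>2 / (k * t) / 2"
  have y: "y > 0"
    using assms by (simp add: y_def)
  have w_le: "w powr p \<le> (C / r * exp (- (2 * y))) powr p"
    using assms by (intro powr_mono2) (auto simp: y_def)
  have w_eq: "(C / r * exp (- (2 * y))) powr p = C powr p * r powr (- p) * exp (- (2 * y) * p)"
    using assms by (simp add: powr_mult powr_divide powr_minus field_simps exp_powr_real)
  have "exp (- (2 * y) * p) \<le> exp (- y) * exp (- y)"
    using y assms mult_left_mono[of 1 p "2 * y"] by (simp flip: exp_add)
  also have "\<dots> \<le> y powr (- \<beta>) * exp (N\<^sup>2 * k * t / 2 - N * r)"
  proof (intro mult_mono)
    show "exp (- y) \<le> y powr (- \<beta>)"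
      using powr_le_exp[of y \<beta>] y assms
      by (simp add: powr_minus exp_minus le_imp_inverse_le)
    \<comment> \<open>Completing the square turns Gaussian into exponential decay.\<close>
    have "0 \<le> (r - N * k * t)\<^sup>2 / (2 * k * t)"
      using assms by simp
    also have "\<dots> = y - N * r + N\<^sup>2 * k * t / 2"
      using assms by (simp add: y_def field_simps power2_eq_square)
    finally show "exp (- y) \<le> exp (N\<^sup>2 * k * t / 2 - N * r)"
      by simp
  qed auto
  also have "y powr (- \<beta>) = (2 * k * t) powr \<beta> * r powr (- (2 * \<beta>))"
  proof -
    have "y = r powr 2 / (2 * k * t)"
      using assms by (simp add: y_def)
    then have "y powr (- \<beta>) = (r powr 2) powr (- \<beta>) / (2 * k * t) powr (- \<beta>)"
      by (simp only: powr_divide)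
    also have "(r powr 2) powr (- \<beta>) = r powr (- (2 * \<beta>))"
      by (simp only: powr_powr) simp
    finally show ?thesis
      by (simp add: powr_minus divide_inverse)
  qed
  finally have "(C / r * exp (- (2 * y))) powr p \<le> C powr p * r powr (- p) *
      ((2 * k * t) powr \<beta> * r powr (- (2 * \<beta>)) * exp (N\<^sup>2 * k * t / 2 - N * r))"
    unfolding w_eq by (intro mult_left_mono) auto
  also have "\<dots> = C powr p * (2 * k * t) powr \<beta> * exp (N\<^sup>2 * k * t / 2)
      * (r powr (- p + - (2 * \<beta>)) * exp (- (N * r)))"
  proof -
    have "exp (N\<^sup>2 * k * t / 2 - N * r) = exp (N\<^sup>2 * k * t / 2) * exp (- (N * r))"
      by (simp flip: exp_add)
    then show ?thesis
      by (simp only: powr_add mult_ac)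
  qed
  finally show ?thesis
    using w_le by (simp add: minus_add_distrib)
qed

text \<open>For \<open>p < n\<close> there is a \<open>\<beta> > 0\<close> with \<open>p + 2 \<beta> < n\<close>, and then \<open>|u|\<^sup>p\<close> is bounded by a fixed
  integrable function of \<open>x\<close> times a factor of order \<open>t powr \<beta>\<close>.\<close>

lemma vanishing_initial_data_of_gaussian_bound:
  fixes u :: "real \<Rightarrow> real ^ 'n::finite \<Rightarrow> real ^ 'm::finite" and C k p :: real
  assumes k: "k > 0" and C: "C \<ge> 0"
    and meas: "\<And>t. t > 0 \<Longrightarrow> u t \<in> borel_measurable borel"
    and bound: "\<And>t x. t > 0 \<Longrightarrow> norm (u t x) \<le> C / norm x * exp (- ((norm x)\<^sup>2 / (k * t)))"
    and p: "1 \<le> p" "p < CARD('n)"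
  shows "vanishing_initial_data p u"
proof -
  define N where "N = real CARD('n)"
  define \<beta> where "\<beta> = min 1 ((N - p) / 4)"
  have \<beta>: "0 < \<beta>" "\<beta> \<le> 1" "p + 2 * \<beta> < N"
  proof -
    have "\<beta> \<le> (N - p) / 4"
      unfolding \<beta>_def by (rule min.cobounded2)
    moreover have "p < N"
      using p by (simp add: N_def)
    ultimately show "p + 2 * \<beta> < N"
      by argo
  qed (use p in \<open>auto simp: \<beta>_def N_def\<close>)
  define g where "g = (\<lambda>x :: real ^ 'n. norm x powr (- (p + 2 * \<beta>)) * exp (- (N * norm x)))"
  define B where "B = (\<lambda>t. C powr p * (2 * k * t) powr \<beta> * exp (N\<^sup>2 * k * t / 2))"
  have g: "integrable lborel g"
    unfolding g_def N_def
    using norm_powr_exp_integrable[where 'a = "real ^ 'n", of "p + 2 * \<beta>"] \<beta> p by (simp add: N_def)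
  \<comment> \<open>At \<open>x = 0\<close> the hypothesis reads \<open>norm (u t 0) \<le> 0\<close>, because \<open>C / 0 = 0\<close>.\<close>
  have le: "norm (u t x) powr p \<le> B t * g x" if t: "t > 0" for t x
  proof (cases "x = 0")
    case True
    then show ?thesis
      using bound[OF t, of x] by (simp add: B_def g_def)
  next
    case False
    then show ?thesis
      using gaussian_singularity_bound[OF k t _ p(1), of "norm x" \<beta> "norm (u t x)" C N] bound[OF t, of x] \<beta> C
      by (simp add: B_def g_def)
  qed
  have int: "integrable lborel (\<lambda>x. norm (u t x) powr p)" if t: "t > 0" for t
  proof (rule Bochner_Integration.integrable_bound)
    show "integrable lborel (\<lambda>x. B t * g x)"
      using g by simp
    show "(\<lambda>x. norm (u t x) powr p) \<in> borel_measurable lborel"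
      using meas[OF t] by measurable
    show "AE x in lborel. norm (norm (u t x) powr p) \<le> norm (B t * g x)"
      using le[OF t] by (intro AE_I2) (smt (verit) powr_ge_zero real_norm_def)
  qed
  have in_Lp: "in_Lp p (u t)" if t: "t > 0" for t
    using meas[OF t] int[OF t] unfolding in_Lp_def
    by (auto intro!: measurable_completion simp: integrable_completion)
  have Lp: "Lp_norm p (u t) \<le> (B t * (LINT x|lborel. g x)) powr (1 / p)" if t: "t > 0" for t
  proof -
    have "(LINT x|lebesgue. norm (u t x) powr p) = (LINT x|lborel. norm (u t x) powr p)"
      using meas[OF t] by (intro integral_completion) measurable
    also have "\<dots> \<le> (LINT x|lborel. B t * g x)"
      using int[OF t] g le[OF t] by (intro integral_mono) auto
    finally have "(LINT x|lebesgue. norm (u t x) powr p) \<le> B t * (LINT x|lborel. g x)"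
      by simp
    then show ?thesis
      unfolding Lp_norm_def using p by (intro powr_mono2 integral_nonneg_AE) auto
  qed
  have "((\<lambda>t. (2 * k * t) powr \<beta>) \<longlongrightarrow> 0) (at_right 0)"
    using k \<beta> by (intro tendsto_zero_powrI[where b = \<beta>]) (auto intro!: tendsto_eq_intros eventually_at_rightI[of 0 1])
  moreover have "((\<lambda>t. exp (N\<^sup>2 * k * t / 2)) \<longlongrightarrow> exp (N\<^sup>2 * k * 0 / 2)) (at_right 0)"
    by (intro tendsto_intros) auto
  ultimately have "(B \<longlongrightarrow> C powr p * 0 * exp (N\<^sup>2 * k * 0 / 2)) (at_right 0)"
    unfolding B_def by (intro tendsto_mult tendsto_const)
  then have "(B \<longlongrightarrow> 0) (at_right 0)"
    by simp
  then have "((\<lambda>t. B t * (LINT x|lborel. g x)) \<longlongrightarrow> 0) (at_right 0)"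
    by (rule tendsto_mult_left_zero)
  then have "((\<lambda>t. (B t * (LINT x|lborel. g x)) powr (1 / p)) \<longlongrightarrow> 0) (at_right 0)"
    using p by (intro tendsto_zero_powrI[where b = "1 / p"])
      (auto intro!: always_eventually mult_nonneg_nonneg integral_nonneg_AE simp: B_def g_def)
  then have "((\<lambda>t. Lp_norm p (u t)) \<longlongrightarrow> 0) (at_right 0)"
  proof (rule tendsto_sandwich[rotated 3, OF _ _ _ tendsto_const])
    show "\<forall>\<^sub>F t in at_right 0. 0 \<le> Lp_norm p (u t)"
      by (simp add: Lp_norm_def)
    show "\<forall>\<^sub>F t in at_right 0. Lp_norm p (u t) \<le> (B t * (LINT x|lborel. g x)) powr (1 / p)"
      using Lp by (intro eventually_at_rightI[of 0 1]) auto
  qed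
  then show ?thesis
    using in_Lp by (simp add: vanishing_initial_data_def)
qed

section \<open>The self-similar fields\<close>

text \<open>At \<open>x = 0\<close> both sides vanish, whatever value the profile takes at \<open>0\<close>.\<close>

lemma u_ss_field_eq_profile:
  fixes x :: "real ^ 'n::finite"
  assumes "\<mu> > 0" "t > 0"
  shows "u_ss_field \<mu> a t x = (profile (CARD('n) / 2) a (x \<bullet> x / (4 * \<mu> * t)) / t) *\<^sub>R x"
proof (cases "x = 0")
  case False
  define n r where "n = real CARD('n)" and "r = norm x"
  have r: "r > 0" "x \<bullet> x = r\<^sup>2"
    using False by (auto simp: r_def power2_norm_eq_inner)
  have "r\<^sup>2 powr (n / 2) = r powr n"
    using r powr_powr[of r 2 "n / 2"] by simp
  then have z: "(r\<^sup>2 / (4 * \<mu> * t)) powr (- (n / 2)) = (4 * \<mu>) powr (n / 2) * t powr (n / 2) * r powr (- n)"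
    using assms r by (simp add: powr_minus powr_divide powr_mult field_simps)
  have "u_ss CARD('n) \<mu> a t r / r
      = (4 * \<mu>) powr (n / 2) * (t powr (n / 2 - 1)) * (r powr (1 - n) / r)
        * (exp (- (r\<^sup>2 / (4 * \<mu> * t))) / (a + gamma_tail (n / 2) (r\<^sup>2 / (4 * \<mu> * t))))"
    by (simp add: u_ss_def gamma_tail_def n_def)
  also have "t powr (n / 2 - 1) = t powr (n / 2) / t"
    using assms by (simp add: powr_diff)
  also have "r powr (1 - n) / r = r powr (- n)"
    using r by (simp add: powr_diff powr_minus field_simps)
  finally have "u_ss CARD('n) \<mu> a t r / r = profile (n / 2) a (r\<^sup>2 / (4 * \<mu> * t)) / t"
    unfolding profile_def z by simp
  moreover have "u_ss_field \<mu> a t x = (u_ss CARD('n) \<mu> a t r / r) *\<^sub>R x"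
    using False by (simp add: u_ss_field_def radial_field_def r_def divide_inverse)
  ultimately show ?thesis
    unfolding r(2) n_def by simp
qed (simp add: u_ss_field_def radial_field_def)

text \<open>The similarity variable is scaling invariant, and the powers of \<open>l\<close> in the prefactor have the
  exponents \<open>1\<close>, \<open>n - 2\<close> and \<open>1 - n\<close>, which add up to \<open>0\<close>.\<close>

lemma u_ss_self_similar: "self_similar (u_ss n \<mu> a)"
  unfolding self_similar_def
proof (intro allI impI)
  fix l t r :: real
  assume pos: "l > 0" "t > 0" "r > 0"
  have z: "(l * r)\<^sup>2 / (4 * \<mu> * (l\<^sup>2 * t)) = r\<^sup>2 / (4 * \<mu> * t)"
    using pos by (simp add: power_mult_distrib)
  have "l\<^sup>2 powr (real n / 2 - 1) = l powr (real n - 2)"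
    using pos powr_powr[of l 2 "real n / 2 - 1"] by (simp add: algebra_simps)
  then have "l * (l\<^sup>2 * t) powr (real n / 2 - 1) * (l * r) powr (1 - real n)
      = (l powr 1 * l powr (real n - 2) * l powr (1 - real n)) * t powr (real n / 2 - 1) * r powr (1 - real n)"
    using pos by (simp add: powr_mult)
  also have "l powr 1 * l powr (real n - 2) * l powr (1 - real n) = 1"
    using pos by (simp only: powr_add[symmetric]) simp
  finally have scale: "l * (l\<^sup>2 * t) powr (real n / 2 - 1) * (l * r) powr (1 - real n)
      = t powr (real n / 2 - 1) * r powr (1 - real n)"
    by simp
  show "u_ss n \<mu> a t r = l * u_ss n \<mu> a (l\<^sup>2 * t) (l * r)"
    unfolding u_ss_def z using scale by (simp add: mult_ac)
qed

text \<open>Differentiating the Riccati equation \<open>H' = H\<^sup>2 - H - \<nu> H / z\<close> once and eliminating \<open>H''\<close> gives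
  exactly the second-order equation for the profile, with \<open>\<nu> = n/2\<close>.\<close>

lemma u_ss_field_classical_solution:
  assumes "\<mu> > 0" "a > 0" "CARD('n::finite) \<ge> 2"
  shows "classical_solution_on \<mu> ({0<..} \<times> (UNIV - {0}))
    (u_ss_field \<mu> a :: real \<Rightarrow> real ^ 'n \<Rightarrow> real ^ 'n)"
proof -
  define \<nu> where "\<nu> = CARD('n) / 2"
  have \<nu>: "\<nu> \<ge> 3/4"
    using assms by (simp add: \<nu>_def)
  define H where "H = profile \<nu> a"
  define H1 where "H1 = (\<lambda>z. (H z)\<^sup>2 - H z - \<nu> * H z / z)"
  define H2 where "H2 = (\<lambda>z. 2 * H z * H1 z - H1 z - \<nu> * (H1 z * z - H z) / z\<^sup>2)"
  have H: "(H has_real_derivative H1 z) (at z)" if "z > 0" for z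
    using profile_riccati[OF \<nu> assms(2) that] by (simp add: H_def H1_def)
  have H1: "(H1 has_real_derivative H2 z) (at z)" if "z > 0" for z
    unfolding H1_def[abs_def]
    using that by (auto intro!: derivative_eq_intros H simp: H2_def power2_eq_square field_simps)
  have cont: "continuous_on {0<..} H" "continuous_on {0<..} H1"
    by (meson DERIV_continuous H H1 continuous_at_imp_continuous_on greaterThan_iff)+
  show ?thesis
  proof (rule classical_solution_of_profile_ode[OF assms(1) H H1])
    show "continuous_on {0<..} H2"
      unfolding H2_def by (intro continuous_intros cont) auto
    show "- H z - z * H1 z + (H z)\<^sup>2 + 2 * z * H z * H1 z = (CARD('n) / 2 + 1) * H1 z + z * H2 z"
      if "z > 0" for z
    proof -
      have 1: "z * H2 z = 2 * z * H z * H1 z - z * H1 z - \<nu> * H1 z + \<nu> * H z / z"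
        using that by (simp add: H2_def field_simps power2_eq_square)
      show ?thesis
        unfolding 1 \<nu>_def[symmetric] by (simp add: H1_def algebra_simps add_divide_distrib)
    qed
    show "u_ss_field \<mu> a t x = (H (x \<bullet> x / (4 * \<mu> * t)) / t) *\<^sub>R x"
      if "t > 0" "x \<noteq> 0" for t and x :: "real ^ 'n"
      using u_ss_field_eq_profile[OF assms(1) that(1)] by (simp add: H_def \<nu>_def)
  qed
qed

lemma u_ss_field_nonzero:
  fixes x :: "real ^ 'n::finite"
  assumes "\<mu> > 0" "a > 0" "t > 0" "x \<noteq> 0"
  shows "u_ss_field \<mu> a t x \<noteq> 0"
  using assms profile_pos[of a "x \<bullet> x / (4 * \<mu> * t)" "CARD('n) / 2"]
  by (simp add: u_ss_field_eq_profile)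

lemma u_ss_field_unbounded:
  assumes "\<mu> > 0" "a > 0" "t > 0" "\<delta> > 0" "CARD('n::finite) \<ge> 2"
  shows "\<not> bounded ((u_ss_field \<mu> a t :: real ^ 'n \<Rightarrow> real ^ 'n) ` ball 0 \<delta>)"
proof
  assume "bounded ((u_ss_field \<mu> a t :: real ^ 'n \<Rightarrow> real ^ 'n) ` ball 0 \<delta>)"
  then obtain M where M: "\<And>x :: real ^ 'n. norm x < \<delta> \<Longrightarrow> norm (u_ss_field \<mu> a t x) \<le> M"
    unfolding bounded_iff by (metis dist_0_norm imageI mem_ball)
  define \<nu> where "\<nu> = CARD('n) / 2"
  have \<nu>: "\<nu> \<ge> 1"
    using assms by (simp add: \<nu>_def)
  define b where "b = 4 * \<mu> * t"
  \<comment> \<open>At a point with similarity variable \<open>z\<close> one has \<open>norm x = sqrt (b * z)\<close>, so the lower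
    bound on \<open>sqrt z * profile \<nu> a z\<close> makes the field at least \<open>K * z powr (- 1/4)\<close> long.\<close>
  define K where "K = exp (- 1) / (a + Gamma (1/4)) * sqrt b / t"
  have b: "b > 0"
    using assms by (simp add: b_def)
  have K: "K > 0"
    using assms b Gamma_real_pos[of "1/4"] by (simp add: K_def add_pos_pos)
  have "filterlim (\<lambda>z :: real. K * z powr (- (1/4))) at_top (at_right 0)"
  proof (rule filterlim_tendsto_pos_mult_at_top[OF tendsto_const K])
    have "LIM z at_right 0. (1/4) * - ln z :> (at_top :: real filter)"
      using ln_at_0
      by (intro filterlim_tendsto_pos_mult_at_top[OF tendsto_const]) (simp_all add: filterlim_uminus_at_top)
    then have "LIM z at_right 0. exp ((1/4) * - ln z) :> (at_top :: real filter)"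
      by (rule filterlim_compose[OF exp_at_top])
    moreover have "\<forall>\<^sub>F z :: real in at_right 0. exp ((1/4) * - ln z) = z powr (- (1/4))"
      by (intro eventually_at_rightI[of 0 1]) (auto simp: powr_def)
    ultimately show "LIM z at_right 0. z powr (- (1/4)) :> (at_top :: real filter)"
      by (rule filterlim_mono_eventually[OF _ order_refl order_refl])
  qed
  then have "\<forall>\<^sub>F z in at_right 0. K * z powr (- (1/4)) > M"
    by (simp add: filterlim_at_top_dense)
  moreover have "((\<lambda>z. sqrt (b * z)) \<longlongrightarrow> sqrt (b * 0)) (at_right 0)"
    by (intro tendsto_intros)
  then have "\<forall>\<^sub>F z in at_right 0. sqrt (b * z) < \<delta>"
    using assms by (intro order_tendstoD) auto
  moreover have "\<forall>\<^sub>F z :: real in at_right 0. z \<in> {0<..<1}"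
    by (intro eventually_at_right_real) simp
  ultimately have "\<forall>\<^sub>F z in at_right 0. K * z powr (- (1/4)) > M \<and> sqrt (b * z) < \<delta> \<and> z \<in> {0<..<1}"
    by (intro eventually_conj)
  then obtain z where z: "K * z powr (- (1/4)) > M" "sqrt (b * z) < \<delta>" "0 < z" "z < 1"
    using eventually_happens[of _ "at_right (0 :: real)"] by (auto simp: trivial_limit_at_right_real)
  define x :: "real ^ 'n" where "x = sqrt (b * z) *\<^sub>R axis undefined 1"
  have nx: "norm x = sqrt (b * z)" and xx: "x \<bullet> x / (4 * \<mu> * t) = z"
    using b z by (auto simp: x_def norm_axis_1 inner_axis_axis b_def)
  have "K * z powr (- (1/4)) \<le> sqrt z * profile \<nu> a z * (sqrt b / t)"
    using mult_right_mono[OF profile_blow_up[OF \<nu> assms(2) z(3)], of "sqrt b / t"] z(4) b assms(3)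
    by (simp add: K_def mult_ac)
  also have "\<dots> = norm (u_ss_field \<mu> a t x)"
  proof -
    have "u_ss_field \<mu> a t x = (profile \<nu> a z / t) *\<^sub>R x"
      unfolding u_ss_field_eq_profile[OF assms(1,3)] xx \<nu>_def ..
    then show ?thesis
      using profile_pos[OF assms(2) z(3), of \<nu>] assms(3) by (simp add: nx real_sqrt_mult)
  qed
  also have "\<dots> \<le> M"
    using z by (intro M) (simp add: nx)
  finally show False
    using z by simp
qed

lemma u_ss_field_vanishing_initial_data:
  assumes "\<mu> > 0" "a > 0" "CARD('n::finite) \<ge> 2" "1 \<le> p" "p < real CARD('n)"
  shows "vanishing_initial_data p (u_ss_field \<mu> a :: real \<Rightarrow> real ^ 'n \<Rightarrow> real ^ 'n)"
proof -
  define \<nu> where "\<nu> = CARD('n) / 2"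
  have \<nu>: "\<nu> \<ge> 1"
    using assms by (simp add: \<nu>_def)
  define C where "C = max (2 powr \<nu> * exp 2) (1 / a)"
  have C: "C \<ge> 0"
    using assms by (simp add: C_def le_max_iff_disj)
  show ?thesis
  proof (rule vanishing_initial_data_of_gaussian_bound[of "4 * \<mu>" "4 * \<mu> * C"])
    show "(u_ss_field \<mu> a t :: real ^ 'n \<Rightarrow> real ^ 'n) \<in> borel_measurable borel" if t: "t > 0" for t
    proof (rule borel_measurable_continuous_countable_exceptions[of "{0}"])
      have "u_ss_field \<mu> a t differentiable (at x)" if "x \<noteq> 0" for x :: "real ^ 'n"
        using u_ss_field_classical_solution[OF assms(1-3)] t that
        by (auto simp: classical_solution_on_def C12_on_def)
      then show "continuous_on (- {0}) (u_ss_field \<mu> a t :: real ^ 'n \<Rightarrow> real ^ 'n)"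
        by (auto intro!: continuous_at_imp_continuous_on differentiable_imp_continuous_within)
    qed simp
    show "norm (u_ss_field \<mu> a t x) \<le> 4 * \<mu> * C / norm x * exp (- ((norm x)\<^sup>2 / (4 * \<mu> * t)))"
      if t: "t > 0" for t and x :: "real ^ 'n"
    proof (cases "x = 0")
      case True
      then show ?thesis
        by (simp add: u_ss_field_def radial_field_def)
    next
      case False
      define z where "z = (norm x)\<^sup>2 / (4 * \<mu> * t)"
      have z: "z > 0" "x \<bullet> x / (4 * \<mu> * t) = z"
        using False assms t by (auto simp: z_def power2_norm_eq_inner)
      have "norm (u_ss_field \<mu> a t x) = 4 * \<mu> / norm x * (z * profile \<nu> a z)"
        using False assms t profile_pos[OF assms(2) z(1), of \<nu>]
        by (simp add: u_ss_field_eq_profile z(2) flip: \<nu>_def)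
           (simp add: z_def power2_eq_square)
      also have "\<dots> \<le> 4 * \<mu> / norm x * (C * exp (- z))"
        using profile_decay[OF \<nu> assms(2) z(1)] assms unfolding C_def
        by (intro mult_left_mono) auto
      finally show ?thesis
        by (simp add: z_def)
    qed
  qed (use assms C in auto)
qed

text \<open>The parameter can be read off at a single point of space-time, the numerator of the profile
  there being positive and independent of \<open>a\<close>.\<close>

lemma u_ss_field_inj:
  assumes "\<mu> > 0"
  shows "inj_on (\<lambda>a. on_positive_times (u_ss_field \<mu> a :: real \<Rightarrow> real ^ 'n::finite \<Rightarrow> real ^ 'n)) {0<..}"
proof (rule inj_onI)
  fix a b :: real
  assume pos: "a \<in> {0<..}" "b \<in> {0<..}"
    and eq: "on_positive_times (u_ss_field \<mu> a :: real \<Rightarrow> real ^ 'n \<Rightarrow> real ^ 'n)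
      = on_positive_times (u_ss_field \<mu> b)"
  define x :: "real ^ 'n" where "x = axis undefined 1"
  define z \<nu> where "z = x \<bullet> x / (4 * \<mu> * 1)" and "\<nu> = CARD('n) / 2"
  have z: "z > 0" and x: "x \<noteq> 0"
    using assms by (auto simp: z_def x_def inner_axis_axis axis_eq_0_iff)
  have "u_ss_field \<mu> a 1 x = u_ss_field \<mu> b 1 x"
    using fun_cong[OF eq, of "(1, x)"] by (simp add: on_positive_times_def)
  then have "profile \<nu> a z = profile \<nu> b z"
    using u_ss_field_eq_profile[OF assms, of 1 _ x] x by (simp add: z_def \<nu>_def)
  then show "a = b"
    using pos z gamma_tail_nonneg[of \<nu> z] by (simp add: profile_def divide_simps split: if_splits)
qed

theorem mainTheorem3:
  fixes \<mu> :: real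
  assumes "\<mu> > 0" and "CARD('n::finite) \<ge> 2"
  shows "(\<forall>a>0. let u = (u_ss_field \<mu> a :: real \<Rightarrow> real ^ 'n \<Rightarrow> real ^ 'n) in
      self_similar (u_ss CARD('n) \<mu> a) \<and>
      classical_solution_on \<mu> ({0<..} \<times> (UNIV - {0})) u \<and>
      (\<forall>t>0. \<forall>x. x \<noteq> 0 \<longrightarrow> u t x \<noteq> 0) \<and>
      (\<forall>t>0. \<forall>\<delta>>0. \<not> bounded (u t ` ball 0 \<delta>)) \<and>
      (\<forall>p::real. 1 \<le> p \<and> p < real CARD('n) \<longrightarrow> vanishing_initial_data p u))
    \<and> infinite {V. \<exists>a>0. \<exists>u. u = (u_ss_field \<mu> a :: real \<Rightarrow> real ^ 'n \<Rightarrow> real ^ 'n) \<and>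
      V = on_positive_times u \<and>
      self_similar (u_ss CARD('n) \<mu> a) \<and>
      classical_solution_on \<mu> ({0<..} \<times> (UNIV - {0})) u \<and>
      (\<forall>p::real. 1 \<le> p \<and> p < real CARD('n) \<longrightarrow> vanishing_initial_data p u)}"
    (is "?props \<and> infinite ?S")
proof
  show ?props
    unfolding Let_def
    by (intro allI impI conjI u_ss_self_similar u_ss_field_classical_solution u_ss_field_nonzero
        u_ss_field_unbounded u_ss_field_vanishing_initial_data) (use assms in auto)
  have "on_positive_times (u_ss_field \<mu> a :: real \<Rightarrow> real ^ 'n \<Rightarrow> real ^ 'n) \<in> ?S" if "a > 0" for a
    unfolding mem_Collect_eq using that assms
    by (intro exI[of _ a] exI[of _ "u_ss_field \<mu> a"] allI impI conjI refl u_ss_self_similar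
        u_ss_field_classical_solution u_ss_field_vanishing_initial_data) auto
  then have "(\<lambda>a. on_positive_times (u_ss_field \<mu> a :: real \<Rightarrow> real ^ 'n \<Rightarrow> real ^ 'n)) ` {0<..} \<subseteq> ?S"
    by (intro image_subsetI) simp
  moreover have "infinite ((\<lambda>a. on_positive_times (u_ss_field \<mu> a :: real \<Rightarrow> real ^ 'n \<Rightarrow> real ^ 'n)) ` {0<..})"
    using u_ss_field_inj[OF assms(1), where 'n = 'n] infinite_Ioi[of "0 :: real"] by (simp add: finite_image_iff)
  ultimately show "infinite ?S"
    by (rule infinite_super)
qed

end
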